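(* Let $\mathbb{F}_q$ be any finite field, and let $M$ be any free matroid, of rank $r(M)$. If $m,n \in \mathbb{N}$ satisfy $m,n \geq r(M)$, then $$ \mathbb{P}_{A \sim [U_q]^{m \times n}}\{M \text{ is a minor of } M[A]\} = q^{-mn}\sum_{k=r(M)}^{\min(m,n)} \left( \binom{\min(m,n)}{k}_q \sum_{i=0}^{k} (-1)^{k-i} \binom{k}{i}_q\, q^{\max(m,n)\, i + \binom{k-i}{2}} \right), $$ where $\binom{a}{b}_q$ (with subscript $q$) denotes the Gaussian coefficient and $\binom{k-i}{2}$ the ordinary binomial coefficient.
   Context: $\mathbb{F}_q$ is the finite field with $q$ elements. $[U_q]^{m\times n}$ denotes the uniform distribution on $\mathbb{F}_q^{m\times n}$ (entries i.i.d. uniform on $\mathbb{F}_q$), and $A \sim [U_q]^{m \times n}$ means that $A$ is drawn from it. For a matrix $A$ over $\mathbb{F}_q$ with $n$ columns, $M[A]$ is the column dependence matroid of $A$: its ground set is the set of column indices $\{1,\dots,n\}$, and a set of indices is independent iff the corresponding columns form a linearly independent family. All matroids are finite. A free matroid is a matroid in which every subset of the ground set is independent. "$M$ is a minor of $N$" means that $M$ is isomorphic to a matroid obtained from $N$ by a sequence of deletions and contractions. Gaussian coefficients are defined for $b\le a$ by $\binom{a}{b}_q = \prod_{i=0}^{b-1} \frac{q^{a-i}-1}{q^{b-i}-1}$. *)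

theory Defs
  imports
    "HOL-Probability.Probability_Mass_Function"
    "Jordan_Normal_Form.VS_Connect"
begin

record 'e matroid =
  ground :: "'e set"
  indeps :: "'e set set"

definition is_matroid :: "'e matroid \<Rightarrow> bool" where
  "is_matroid M \<longleftrightarrow>
     finite (ground M) \<and>
     indeps M \<subseteq> Pow (ground M) \<and>
     {} \<in> indeps M \<and>
     (\<forall>I\<in>indeps M. \<forall>J. J \<subseteq> I \<longrightarrow> J \<in> indeps M) \<and>
     (\<forall>I\<in>indeps M. \<forall>J\<in>indeps M. card I < card J \<longrightarrow>
        (\<exists>x\<in>J - I. insert x I \<in> indeps M))"

definition free_matroid :: "'e matroid \<Rightarrow> bool" where
  "free_matroid M \<longleftrightarrow> is_matroid M \<and> (\<forall>S. S \<subseteq> ground M \<longrightarrow> S \<in> indeps M)"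

definition matroid_rank :: "'e matroid \<Rightarrow> nat" where
  "matroid_rank M = Max (card ` indeps M)"

definition basis_in :: "'e matroid \<Rightarrow> 'e set \<Rightarrow> 'e set \<Rightarrow> bool" where
  "basis_in M X B \<longleftrightarrow> B \<in> indeps M \<and> B \<subseteq> X \<and>
     (\<forall>B'\<in>indeps M. B \<subseteq> B' \<longrightarrow> B' \<subseteq> X \<longrightarrow> B' = B)"

definition matroid_delete :: "'e matroid \<Rightarrow> 'e set \<Rightarrow> 'e matroid" where
  "matroid_delete M T =
     \<lparr>ground = ground M - T, indeps = {I \<in> indeps M. I \<subseteq> ground M - T}\<rparr>"

(* In a matroid, whether I \<union> B is independent does not depend on the choice of the basis B of T. *)
definition matroid_contract :: "'e matroid \<Rightarrow> 'e set \<Rightarrow> 'e matroid" where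
  "matroid_contract M T =
     \<lparr>ground = ground M - T,
      indeps = {I. I \<subseteq> ground M - T \<and> (\<exists>B. basis_in M T B \<and> I \<union> B \<in> indeps M)}\<rparr>"

inductive minor_seq :: "'e matroid \<Rightarrow> 'e matroid \<Rightarrow> bool" for N :: "'e matroid" where
  refl: "minor_seq N N"
| delete: "minor_seq N M \<Longrightarrow> T \<subseteq> ground M \<Longrightarrow> minor_seq N (matroid_delete M T)"
| contract: "minor_seq N M \<Longrightarrow> T \<subseteq> ground M \<Longrightarrow> minor_seq N (matroid_contract M T)"

definition matroid_iso :: "'e matroid \<Rightarrow> 'f matroid \<Rightarrow> bool" where
  "matroid_iso M N \<longleftrightarrow> (\<exists>f. bij_betw f (ground M) (ground N) \<and>
     (\<forall>S. S \<subseteq> ground M \<longrightarrow> (S \<in> indeps M \<longleftrightarrow> f ` S \<in> indeps N)))"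

definition is_minor :: "'e matroid \<Rightarrow> 'f matroid \<Rightarrow> bool" where
  "is_minor M N \<longleftrightarrow> (\<exists>N'. minor_seq N N' \<and> matroid_iso M N')"

(* Injectivity makes this independence of the family of columns: a repeated column is a
   dependence, although it disappears in the image set. *)
definition cols_indpt :: "'a::field mat \<Rightarrow> nat set \<Rightarrow> bool" where
  "cols_indpt A I \<longleftrightarrow> inj_on (col A) I \<and>
     \<not> module.lin_dep class_ring (module_vec TYPE('a) (dim_row A)) (col A ` I)"

(* Columns are indexed from 0. *)
definition column_matroid :: "'a::field mat \<Rightarrow> nat matroid" where
  "column_matroid A =
     \<lparr>ground = {..<dim_col A}, indeps = {I. I \<subseteq> {..<dim_col A} \<and> cols_indpt A I}\<rparr>"

(* pmf_of_set is only meaningful on finite nonempty sets. *)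
lemma finite_carrier_mat: "finite (carrier_mat m n :: 'a::finite mat set)"
proof (rule finite_surj)
  let ?D = "{..<m} \<times> {..<n}"
  show "finite (?D \<rightarrow>\<^sub>E (UNIV :: 'a set))"
    by (intro finite_PiE) auto
  show "carrier_mat m n \<subseteq> mat m n ` (?D \<rightarrow>\<^sub>E (UNIV :: 'a set))"
  proof
    fix A :: "'a mat"
    assume "A \<in> carrier_mat m n"
    then have "A = mat m n (restrict (($$) A) ?D)"
      by (intro eq_matI) auto
    moreover have "restrict (($$) A) ?D \<in> ?D \<rightarrow>\<^sub>E UNIV"
      by auto
    ultimately show "A \<in> mat m n ` (?D \<rightarrow>\<^sub>E UNIV)"
      by (rule image_eqI)
  qed
qed

lemma carrier_mat_nonempty: "carrier_mat m n \<noteq> ({} :: 'a::zero mat set)"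
  using zero_carrier_mat[of m n] by blast

definition uniform_mat :: "nat \<Rightarrow> nat \<Rightarrow> 'a::{field,finite} mat pmf" where
  "uniform_mat m n = pmf_of_set (carrier_mat m n)"

(* Used for b \<le> a only, so that the subtractions on nat are exact. *)
definition gaussian_coeff :: "nat \<Rightarrow> nat \<Rightarrow> nat \<Rightarrow> real" where
  "gaussian_coeff q a b =
     (\<Prod>i<b. (real q ^ (a - i) - 1) / (real q ^ (b - i) - 1))"

end

theory Submission
  imports Defs "Jordan_Normal_Form.DL_Rank"
begin

text \<open>
  Every independent set of a minor of \<open>N\<close> extends to an independent set of \<open>N\<close>, so a free matroid
  of rank \<open>r\<close> is a minor of \<open>M[A]\<close> if and only if \<open>r \<le> rank A\<close>. The matrices of rank \<open>k\<close> are
  counted column by column: a new column either lies in the span of the previous ones, which has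
  \<open>q\<^sup>k\<close> elements, or raises the rank. By the Pascal rule, the resulting recurrence is solved by the
  Gaussian coefficient of \<open>n\<close> over \<open>k\<close> times \<open>\<Prod>i<k. q\<^sup>m - q\<^sup>i\<close>. This is symmetric in \<open>m\<close> and \<open>n\<close>,
  and the inner sum of the statement is the expansion of that product by the \<open>q\<close>-binomial theorem.
\<close>

section \<open>Gaussian coefficients\<close>

lemma gaussian_coeff_0_right [simp]: "gaussian_coeff q a 0 = 1"
  by (simp add: gaussian_coeff_def)

text \<open>The factor for \<open>i = a\<close> has numerator \<open>q ^ 0 - 1\<close>. Truncated
  subtraction thus yields the conventional value outside the range \<open>b \<le> a\<close>, so
  boundary terms in the sums and recurrences vanish by themselves.\<close>

lemma gaussian_coeff_eq_0:
  assumes "a < b"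
  shows "gaussian_coeff q a b = 0"
  unfolding gaussian_coeff_def
  by (rule prod_zero) (use assms in \<open>auto intro!: bexI[of _ a]\<close>)

lemma real_power_inject_exp:
  assumes "2 \<le> q"
  shows "real q ^ a = real q ^ b \<longleftrightarrow> a = b"
  using assms by simp

text \<open>For \<open>x = q ^ m\<close> this counts the ordered linearly independent
  \<open>k\<close>-tuples in an \<open>m\<close>-dimensional space over a field with
  \<open>q\<close> elements. A general \<open>x\<close> is allowed because the
  \<open>q\<close>-binomial theorem is a polynomial identity in \<open>x\<close>.\<close>

definition power_diff_prod :: "real \<Rightarrow> real \<Rightarrow> nat \<Rightarrow> real" where
  "power_diff_prod q x k = (\<Prod>i<k. x - q ^ i)"

lemma power_diff_prod_0 [simp]: "power_diff_prod q x 0 = 1"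
  by (simp add: power_diff_prod_def)

lemma power_diff_prod_Suc [simp]:
  "power_diff_prod q x (Suc k) = power_diff_prod q x k * (x - q ^ k)"
  by (simp add: power_diff_prod_def)

text \<open>Each of the \<open>k\<close> factors of positive index is \<open>q\<close> times a
  factor of the product for \<open>x\<close>; the factor of index 0 is
  \<open>q * x - 1\<close>.\<close>

lemma power_diff_prod_shift:
  "power_diff_prod q (q * x) (Suc k) = q ^ k * (q * x - 1) * power_diff_prod q x k"
proof (induction k)
  case (Suc k)
  have "power_diff_prod q (q * x) (Suc (Suc k)) =
      q ^ k * (q * x - 1) * power_diff_prod q x k * (q * x - q ^ Suc k)"
    using Suc by simp
  then show ?case by (simp add: algebra_simps)
qed simp

lemma power_diff_prod_nonzero:
  assumes "2 \<le> q" "k \<le> n"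
  shows "power_diff_prod (real q) (real q ^ n) k \<noteq> 0"
  using assms by (auto simp: power_diff_prod_def real_power_inject_exp)

text \<open>Numerator and denominator of the factor of index \<open>i\<close> are both multiplied by
  \<open>q ^ i\<close>. For \<open>n < k\<close> both sides vanish, on the right through the factor
  of index \<open>n\<close>.\<close>

lemma gaussian_coeff_conv_prod:
  assumes q: "2 \<le> q"
  shows "gaussian_coeff q n k =
    power_diff_prod (real q) (real q ^ n) k / power_diff_prod (real q) (real q ^ k) k"
proof (cases "k \<le> n")
  case True
  have "gaussian_coeff q n k = (\<Prod>i<k. (real q ^ n - real q ^ i) / (real q ^ k - real q ^ i))"
    unfolding gaussian_coeff_def
  proof (rule prod.cong)
    fix i assume i: "i \<in> {..<k}"
    have eq: "real q ^ a - real q ^ i = real q ^ i * (real q ^ (a - i) - 1)" if "i \<le> a" for a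
      using that by (simp add: right_diff_distrib flip: power_add)
    show "(real q ^ (n - i) - 1) / (real q ^ (k - i) - 1) =
      (real q ^ n - real q ^ i) / (real q ^ k - real q ^ i)"
      using eq[of n] eq[of k] i True q by simp
  qed simp
  then show ?thesis
    by (simp add: power_diff_prod_def prod_dividef)
next
  case False
  then have "power_diff_prod (real q) (real q ^ n) k = 0"
    unfolding power_diff_prod_def by (intro prod_zero) (auto intro!: bexI[of _ n])
  with False show ?thesis
    by (simp add: gaussian_coeff_eq_0)
qed

text \<open>With all three coefficients written over \<open>P\<close> and \<open>D\<close>, and with
  \<open>N = q ^ n\<close> and \<open>K = q ^ k\<close>, what remains is
  \<open>q * N - 1 = q * (N - K) + (q * K - 1)\<close>.\<close>

lemma gaussian_coeff_Suc_Suc: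
  assumes q: "2 \<le> q"
  shows "gaussian_coeff q (Suc n) (Suc k) =
    real q ^ Suc k * gaussian_coeff q n (Suc k) + gaussian_coeff q n k"
proof -
  let ?Q = "real q"
  define P where "P = power_diff_prod ?Q (?Q ^ n) k"
  define D where "D = power_diff_prod ?Q (?Q ^ k) k"
  have D: "D \<noteq> 0"
    unfolding D_def using q by (rule power_diff_prod_nonzero) simp
  have k: "?Q ^ k \<noteq> 0" "?Q * ?Q ^ k - 1 \<noteq> 0"
    using q real_power_inject_exp[OF q, of "Suc k" 0] by auto
  have 1: "gaussian_coeff q (Suc n) (Suc k) = (?Q * ?Q ^ n - 1) * P / ((?Q * ?Q ^ k - 1) * D)"
    unfolding gaussian_coeff_conv_prod[OF q] power_Suc power_diff_prod_shift P_def D_def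
    using q by (simp add: mult_ac)
  \<comment> \<open>Here the numerator loses its last factor, while the denominator is
    shifted.\<close>
  have 2: "gaussian_coeff q n (Suc k) =
      P * (?Q ^ n - ?Q ^ k) / (?Q ^ k * (?Q * ?Q ^ k - 1) * D)"
    unfolding gaussian_coeff_conv_prod[OF q] power_Suc power_diff_prod_shift P_def D_def
    by simp
  have 3: "gaussian_coeff q n k = P / D"
    unfolding gaussian_coeff_conv_prod[OF q] P_def D_def ..
  show ?thesis
    unfolding 1 2 3 using k D by (simp add: divide_simps) (simp add: algebra_simps)
qed

text \<open>In quotient form the denominator depends on \<open>k\<close> only, so the product is
  symmetric in \<open>a\<close> and \<open>b\<close>. This reflects that transposition preserves
  rank.\<close>

lemma gaussian_coeff_mult_power_diff_prod_swap:
  assumes "2 \<le> q"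
  shows "gaussian_coeff q a k * power_diff_prod (real q) (real q ^ b) k =
    gaussian_coeff q b k * power_diff_prod (real q) (real q ^ a) k"
  by (simp add: gaussian_coeff_conv_prod[OF assms])

text \<open>The Pascal rule splits the sum for \<open>Suc k\<close> into \<open>- q ^ k\<close>
  times and \<open>x\<close> times the sum for \<open>k\<close>, matching the new factor
  \<open>x - q ^ k\<close>.\<close>

lemma q_binomial_theorem:
  assumes q: "2 \<le> q"
  shows "power_diff_prod (real q) x k =
    (\<Sum>i\<le>k. (-1) ^ (k - i) * gaussian_coeff q k i * x ^ i * real q ^ ((k - i) choose 2))"
proof (induction k)
  case 0
  then show ?case by (simp add: numeral_2_eq_2)
next
  case (Suc k)
  let ?Q = "real q"
  let ?t = "\<lambda>k i. (-1) ^ (k - i) * gaussian_coeff q k i * x ^ i * ?Q ^ ((k - i) choose 2)"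
  \<comment> \<open>The share of \<open>?t (Suc k) i\<close> that comes from the summand of the
    Pascal rule with the power of \<open>q\<close>; for \<open>i = 0\<close> it is the whole
    term.\<close>
  let ?u = "\<lambda>i. (-1) ^ (Suc k - i) * (?Q ^ i * gaussian_coeff q k i) * x ^ i * ?Q ^ ((Suc k - i) choose 2)"
  have choose: "Suc l choose 2 = (l choose 2) + l" for l
    by (simp add: numeral_2_eq_2)
  have u: "?u i = - ?t k i * ?Q ^ k" if le: "i \<le> k" for i
  proof -
    obtain l where l: "k = i + l" using le_Suc_ex[OF le] by blast
    have "Suc k - i = Suc l" "k - i = l"
      using l by simp_all
    moreover have "?Q ^ k = ?Q ^ i * ?Q ^ l"
      unfolding l by (rule power_add)
    ultimately show ?thesis
      by (simp only: choose power_add power_Suc) (simp add: mult_ac)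
  qed
  have split: "?t (Suc k) (Suc i) = ?u (Suc i) + ?t k i * x" if "i \<le> k" for i
    by (simp add: gaussian_coeff_Suc_Suc[OF q] algebra_simps)
  have "(\<Sum>i\<le>Suc k. ?t (Suc k) i) = ?u 0 + (\<Sum>i\<le>k. ?u (Suc i) + ?t k i * x)"
    unfolding sum.atMost_Suc_shift using split by simp
  also have "\<dots> = (\<Sum>i\<le>Suc k. ?u i) + (\<Sum>i\<le>k. ?t k i) * x"
    unfolding sum.atMost_Suc_shift[of ?u] sum.distrib sum_distrib_right by simp
  \<comment> \<open>The last term contains \<open>gaussian_coeff q k (Suc k)\<close>, which is
    0.\<close>
  also have "(\<Sum>i\<le>Suc k. ?u i) = (\<Sum>i\<le>k. ?u i)"
    by (simp add: gaussian_coeff_eq_0)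
  also have "\<dots> = (\<Sum>i\<le>k. - ?t k i * ?Q ^ k)"
    using u by simp
  also have "\<dots> = - (\<Sum>i\<le>k. ?t k i) * ?Q ^ k"
    by (simp add: sum_distrib_right sum_negf)
  finally show ?case
    using Suc by (simp add: algebra_simps)
qed

section \<open>Free minors\<close>

text \<open>Deletion only removes independent sets, and an independent set of a contraction becomes
  independent before it once a basis of the contracted set is added.\<close>

lemma minor_seq_indeps:
  assumes "minor_seq N N'" "I \<in> indeps N'"
  shows "\<exists>J\<in>indeps N. I \<subseteq> J"
  using assms
proof (induction arbitrary: I rule: minor_seq.induct)
  case refl
  then show ?case by blast
next
  case (delete M T)
  then show ?case by (auto simp: matroid_delete_def)
next
  case (contract M T)
  then obtain B where "I \<union> B \<in> indeps M"
    by (auto simp: matroid_contract_def)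
  then show ?case
    using contract.IH by blast
qed

lemma free_matroid_ground:
  assumes "free_matroid M"
  shows "finite (ground M)" "indeps M = Pow (ground M)" "matroid_rank M = card (ground M)"
proof -
  show fin: "finite (ground M)" and ind: "indeps M = Pow (ground M)"
    using assms by (auto simp: free_matroid_def is_matroid_def)
  show "matroid_rank M = card (ground M)"
    unfolding matroid_rank_def ind using fin by (intro Max_eqI) (auto intro: card_mono)
qed

text \<open>The ground set of a free minor is independent in that minor, hence also in
  \<open>N\<close>. Conversely, deleting everything outside an independent set leaves a free matroid
  on that set.\<close>

lemma free_matroid_is_minor_iff:
  fixes M :: "'e matroid" and N :: "'f matroid"
  assumes free: "free_matroid M"
    and fin: "finite (ground N)" and ground: "indeps N \<subseteq> Pow (ground N)"
    and down: "\<And>I J. I \<in> indeps N \<Longrightarrow> J \<subseteq> I \<Longrightarrow> J \<in> indeps N"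
  shows "is_minor M N \<longleftrightarrow> (\<exists>I\<in>indeps N. card I = matroid_rank M)"
proof
  assume "is_minor M N"
  then obtain N' f where N': "minor_seq N N'" and f: "bij_betw f (ground M) (ground N')"
    and iso: "\<And>S. S \<subseteq> ground M \<Longrightarrow> S \<in> indeps M \<longleftrightarrow> f ` S \<in> indeps N'"
    unfolding is_minor_def matroid_iso_def by blast
  have "f ` ground M \<in> indeps N'"
    using iso[of "ground M"] free_matroid_ground[OF free] by simp
  then have "ground N' \<in> indeps N'"
    using f by (simp add: bij_betw_def)
  then obtain J where "J \<in> indeps N" "ground N' \<subseteq> J"
    using minor_seq_indeps[OF N'] by blast
  then have "ground N' \<in> indeps N"
    using down by blast
  moreover have "card (ground N') = matroid_rank M"
    using bij_betw_same_card[OF f] free_matroid_ground[OF free] by simp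
  ultimately show "\<exists>I\<in>indeps N. card I = matroid_rank M" by blast
next
  assume "\<exists>I\<in>indeps N. card I = matroid_rank M"
  then obtain I where I: "I \<in> indeps N" "card I = matroid_rank M" by blast
  let ?N' = "matroid_delete N (ground N - I)"
  have sub: "I \<subseteq> ground N" using I ground by auto
  have "minor_seq N ?N'"
    by (intro minor_seq.delete minor_seq.refl) auto
  moreover have gr: "ground ?N' = I"
    using sub by (auto simp: matroid_delete_def)
  moreover have ind: "indeps ?N' = Pow I"
    using sub down[OF I(1)] ground by (auto simp: matroid_delete_def)
  moreover have "finite I" using sub fin by (rule finite_subset)
  then obtain f where f: "bij_betw f (ground M) I"
    using finite_same_card_bij[of "ground M" I] I(2) free_matroid_ground[OF free] by auto
  have "matroid_iso M ?N'"
    unfolding matroid_iso_def gr ind using f free_matroid_ground[OF free]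
    by (intro exI[of _ f]) (auto simp: bij_betw_def)
  ultimately show "is_minor M N"
    unfolding is_minor_def by blast
qed

section \<open>Counting matrices by rank\<close>

context vec_space
begin

text \<open>Applied to \<open>set (cols A)\<close>, this unfolds to the same term as
  \<open>rank A\<close>; arbitrary sets are allowed so that columns can be added one at a
  time.\<close>

definition span_dim :: "'a vec set \<Rightarrow> nat" where
  "span_dim S = vectorspace.dim class_ring (span_vs S)"

lemma maximal_lin_indpt_exists:
  assumes "finite S"
  obtains U where "maximal U (\<lambda>T. T \<subseteq> S \<and> lin_indpt T)"
  using maximal_exists_superset[of S "\<lambda>T. T \<subseteq> S \<and> lin_indpt T" "{}"] assms
  by (auto simp: lin_dep_def)

text \<open>A vector of \<open>S\<close> outside \<open>span U\<close> could be added to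
  \<open>U\<close>, against maximality.\<close>

lemma span_maximal_lin_indpt:
  assumes S: "S \<subseteq> carrier_vec n" and U: "maximal U (\<lambda>T. T \<subseteq> S \<and> lin_indpt T)"
  shows "span U = span S"
proof
  have U': "U \<subseteq> S" "lin_indpt U" using U by (auto simp: maximal_def)
  then show "span U \<subseteq> span S" by (intro span_is_monotone)
  have "s \<in> span U" if s: "s \<in> S" for s
  proof (cases "s \<in> U")
    case True
    then show ?thesis using in_own_span[of U] U' S by auto
  next
    case False
    have "lin_dep (U \<union> {s})"
    proof (rule ccontr)
      assume "\<not> lin_dep (U \<union> {s})"
      then have "U \<union> {s} = U"
        using U s U' unfolding maximal_def by blast
      with False show False by auto
    qed
    then show ?thesis
      using lin_dep_iff_in_span[of U s] U' S s False by auto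
  qed
  then show "span S \<subseteq> span U"
    using U' S by (intro span_subsetI) auto
qed

lemma span_dim_maximal_lin_indpt:
  assumes "S \<subseteq> carrier_vec n" "finite S" "maximal U (\<lambda>T. T \<subseteq> S \<and> lin_indpt T)"
  shows "span_dim S = card U"
  unfolding span_dim_def using dim_span[of S U] assms by simp

lemma span_dim_insert:
  assumes S: "S \<subseteq> carrier_vec n" "finite S" and c: "c \<in> carrier_vec n"
  shows "span_dim (insert c S) = (if c \<in> span S then span_dim S else Suc (span_dim S))"
proof (cases "c \<in> span S")
  case True
  then have "span (insert c S) = span S"
    using already_in_span[of S c] S by simp
  with True show ?thesis
    by (simp add: span_dim_def)
next
  case False
  obtain U where U: "maximal U (\<lambda>T. T \<subseteq> S \<and> lin_indpt T)"
    using maximal_lin_indpt_exists S(2) by blast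
  then have U': "U \<subseteq> S" "lin_indpt U" by (auto simp: maximal_def)
  have "c \<notin> S" using False in_own_span[of S] S by auto
  have "lin_indpt (U \<union> {c})"
    using lin_dep_iff_in_span[of U c] False span_maximal_lin_indpt[OF S(1) U] U' S c \<open>c \<notin> S\<close>
    by auto
  \<comment> \<open>Maximality of \<open>insert c U\<close> in \<open>insert c S\<close> is reduced
    to that of \<open>U\<close> in \<open>S\<close> by removing \<open>c\<close> from a larger
    independent set.\<close>
  moreover have "B = insert c U" if "insert c U \<subseteq> B" "B \<subseteq> insert c S" "lin_indpt B" for B
  proof -
    have "lin_indpt (B - {c})" using subset_li_is_li[OF that(3)] by blast
    moreover have "U \<subseteq> B - {c}" using U' that \<open>c \<notin> S\<close> by auto
    moreover have "B - {c} \<subseteq> S" using that by auto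
    ultimately have "B - {c} = U" using U unfolding maximal_def by blast
    then show ?thesis using that by auto
  qed
  ultimately have "maximal (insert c U) (\<lambda>T. T \<subseteq> insert c S \<and> lin_indpt T)"
    unfolding maximal_def using U' by auto
  then have "span_dim (insert c S) = card (insert c U)"
    using S c by (intro span_dim_maximal_lin_indpt) auto
  also have "\<dots> = Suc (card U)"
    using U' \<open>c \<notin> S\<close> S by (meson card_insert_disjoint finite_subset subsetD)
  finally show ?thesis
    using span_dim_maximal_lin_indpt[OF S U] False by simp
qed

text \<open>Passes between index sets and sets of vectors. Injectivity preserves the cardinality in
  one direction; in the other, one index is chosen for each vector of an independent set of
  columns.\<close>

lemma ex_card_lin_indpt_cols_iff:
  assumes A: "A \<in> carrier_mat n nc"
  shows "(\<exists>I\<subseteq>{..<nc}. cols_indpt A I \<and> card I = r) \<longleftrightarrow> r \<le> rank A"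
proof -
  have cols: "set (cols A) = col A ` {..<nc}" "set (cols A) \<subseteq> carrier_vec n"
    using A by (auto simp: cols_def)
  have indpt: "cols_indpt A I \<longleftrightarrow> inj_on (col A) I \<and> lin_indpt (col A ` I)" for I
    using A by (simp add: cols_indpt_def)
  show ?thesis
  proof
    assume "\<exists>I\<subseteq>{..<nc}. cols_indpt A I \<and> card I = r"
    then obtain I where I: "I \<subseteq> {..<nc}" "inj_on (col A) I" "lin_indpt (col A ` I)" "card I = r"
      unfolding indpt by blast
    have "card (col A ` I) \<le> rank A"
      using A I(1,3) cols by (intro rank_ge_card_indpt) auto
    then show "r \<le> rank A"
      using I by (simp add: card_image)
  next
    assume r: "r \<le> rank A"
    obtain U where U: "maximal U (\<lambda>T. T \<subseteq> set (cols A) \<and> lin_indpt T)"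
      using maximal_lin_indpt_exists by blast
    then have U': "U \<subseteq> set (cols A)" "lin_indpt U" by (auto simp: maximal_def)
    have "r \<le> card U"
      using r rank_card_indpt[OF A U] by simp
    then obtain W where W: "W \<subseteq> U" "card W = r"
      by (meson obtain_subset_with_card_n)
    then have "W \<subseteq> col A ` {..<nc}" "lin_indpt W"
      using U' cols subset_li_is_li by auto
    then obtain I where "I \<subseteq> {..<nc}" "inj_on (col A) I" "W = col A ` I"
      unfolding subset_image_inj by blast
    then show "\<exists>I\<subseteq>{..<nc}. cols_indpt A I \<and> card I = r"
      unfolding indpt using W \<open>lin_indpt W\<close> by (auto simp: card_image)
  qed
qed

end

lemma card_UNIV_ge_2: "2 \<le> CARD('a::{zero_neq_one,finite})"
proof -
  have "card {0::'a, 1} \<le> CARD('a)"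
    by (rule card_mono) auto
  then show ?thesis by simp
qed

section \<open>Cardinalities of vector spaces over a finite field\<close>

locale finite_vec_space = vec_space f_ty n
  for f_ty :: "'a::{field,finite} itself" and n :: nat
begin

lemma finite_carrier_vec: "finite (carrier_vec n :: 'a vec set)"
proof -
  have "carrier_vec n \<subseteq> (\<lambda>A. col A 0) ` (carrier_mat n 1 :: 'a mat set)"
  proof
    fix v :: "'a vec" assume "v \<in> carrier_vec n"
    then have "v = col (mat_of_cols n [v]) 0" by simp
    then show "v \<in> (\<lambda>A. col A 0) ` (carrier_mat n 1 :: 'a mat set)"
      by (rule image_eqI) auto
  qed
  then show ?thesis
    using finite_carrier_mat finite_surj by blast
qed

text \<open>Each vector of the span has unique coefficients. They are taken as extensional functions
  on \<open>U\<close>, since values outside \<open>U\<close> do not affect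
  \<open>lincomb\<close>.\<close>

lemma card_span_lin_indpt:
  assumes U: "finite U" "U \<subseteq> carrier_vec n" "lin_indpt U"
  shows "card (span U) = CARD('a) ^ card U"
proof -
  have closed: "lincomb a U \<in> carrier_vec n" for a
    using lincomb_closed[of U a] U by simp
  have "inj_on (\<lambda>a. lincomb a U) (U \<rightarrow>\<^sub>E (UNIV :: 'a set))"
  proof (rule inj_onI)
    fix a b :: "'a vec \<Rightarrow> 'a"
    assume a: "a \<in> U \<rightarrow>\<^sub>E UNIV" and b: "b \<in> U \<rightarrow>\<^sub>E UNIV"
      and eq: "lincomb a U = lincomb b U"
    have "lincomb (\<lambda>v. a v - b v) U = lincomb b U \<ominus>\<^bsub>V\<^esub> lincomb b U"
      using lincomb_diff[of U a b] U eq by simp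
    also have "\<dots> = 0\<^sub>v n"
      using M.r_neg[of "lincomb b U"] closed by (simp add: a_minus_def)
    finally have "a v - b v = 0" if "v \<in> U" for v
      using lin_dep_crit[OF U(1) subset_refl, of v "\<lambda>v. a v - b v"] U that by auto
    then show "a = b"
      using a b by (intro PiE_ext[of a U "\<lambda>_. UNIV" b]) auto
  qed
  moreover have "span U = (\<lambda>a. lincomb a U) ` (U \<rightarrow>\<^sub>E (UNIV :: 'a set))"
  proof -
    have "lincomb a U = lincomb (restrict a U) U" for a
      using U by (intro lincomb_cong) auto
    then have "range (\<lambda>a. lincomb a U) = (\<lambda>a. lincomb a U) ` (U \<rightarrow>\<^sub>E (UNIV :: 'a set))"
      by (auto intro!: image_eqI[of _ _ "restrict _ U"])
    then show ?thesis
      using finite_span[of U] U by auto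
  qed
  ultimately show ?thesis
    using U by (simp add: card_image card_PiE)
qed

lemma card_span:
  assumes S: "S \<subseteq> carrier_vec n" "finite S"
  shows "card (span S) = CARD('a) ^ span_dim S"
proof -
  obtain U where U: "maximal U (\<lambda>T. T \<subseteq> S \<and> lin_indpt T)"
    using maximal_lin_indpt_exists S(2) by blast
  then have U': "U \<subseteq> S" "lin_indpt U" by (auto simp: maximal_def)
  then have "card (span U) = CARD('a) ^ card U"
    using S by (intro card_span_lin_indpt) (auto intro: finite_subset)
  then show ?thesis
    using span_maximal_lin_indpt[OF S(1) U] span_dim_maximal_lin_indpt[OF S U] by simp
qed

lemma card_carrier_vec: "card (carrier_vec n :: 'a vec set) = CARD('a) ^ n"
proof -
  have "card (span (set (unit_vecs n)) :: 'a vec set) = CARD('a) ^ card (set (unit_vecs n) :: 'a vec set)"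
    using unit_vecs_basis unfolding basis_def by (intro card_span_lin_indpt) auto
  then show ?thesis
    by (simp add: span_unit_vecs_is_carrier distinct_card unit_vecs_distinct)
qed

lemma card_carrier_mat: "card (carrier_mat n nc :: 'a mat set) = CARD('a) ^ (n * nc)"
proof -
  have "bij_betw cols (carrier_mat n nc :: 'a mat set) {cs. set cs \<subseteq> carrier_vec n \<and> length cs = nc}"
  proof (rule bij_betwI[where g = "mat_of_cols n"])
    show "cols \<in> (carrier_mat n nc :: 'a mat set) \<rightarrow> {cs. set cs \<subseteq> carrier_vec n \<and> length cs = nc}"
    proof
      fix A :: "'a mat" assume "A \<in> carrier_mat n nc"
      then show "cols A \<in> {cs. set cs \<subseteq> carrier_vec n \<and> length cs = nc}"
        using cols_dim[of A] by auto
    qed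
  qed auto
  then have "card (carrier_mat n nc :: 'a mat set) = (CARD('a) ^ n) ^ nc"
    using card_lists_length_eq[OF finite_carrier_vec, of nc]
    by (simp add: bij_betw_same_card card_carrier_vec)
  then show ?thesis
    by (simp add: power_mult)
qed

section \<open>Lists of vectors counted by the dimension of their span\<close>

definition vec_lists :: "nat \<Rightarrow> nat \<Rightarrow> 'a vec list set" where
  "vec_lists l k = {cs. length cs = l \<and> set cs \<subseteq> carrier_vec n \<and> span_dim (set cs) = k}"

lemma finite_vec_lists: "finite (vec_lists l k)"
  by (rule finite_subset[OF _ finite_lists_length_eq[OF finite_carrier_vec, of l]])
    (auto simp: vec_lists_def)

text \<open>Counts the ways to add a vector without changing the dimension.\<close>

lemma card_Sigma_span:
  "card (Sigma (vec_lists l k) (\<lambda>cs. span (set cs))) = card (vec_lists l k) * CARD('a) ^ k"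
proof -
  have "finite (span (set cs))" if "cs \<in> vec_lists l k" for cs
    using that span_is_subset2[of "set cs"] finite_carrier_vec
    by (auto simp: vec_lists_def intro: finite_subset)
  then have "card (Sigma (vec_lists l k) (\<lambda>cs. span (set cs))) =
      (\<Sum>cs\<in>vec_lists l k. card (span (set cs)))"
    by (simp add: card_SigmaI finite_vec_lists)
  also have "\<dots> = (\<Sum>cs\<in>vec_lists l k. CARD('a) ^ k)"
    by (rule sum.cong[OF HOL.refl]) (auto simp: vec_lists_def card_span)
  finally show ?thesis by simp
qed

text \<open>Counts the ways to add a vector that raises the dimension.\<close>

lemma card_Sigma_Diff_span:
  "real (card (Sigma (vec_lists l k) (\<lambda>cs. carrier_vec n - span (set cs)))) =
    real (card (vec_lists l k)) * (real CARD('a) ^ n - real CARD('a) ^ k)"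
proof -
  have sub: "span (set cs) \<subseteq> carrier_vec n" if "cs \<in> vec_lists l k" for cs
    using that span_is_subset2[of "set cs"] by (auto simp: vec_lists_def)
  have "card (Sigma (vec_lists l k) (\<lambda>cs. carrier_vec n - span (set cs))) =
      (\<Sum>cs\<in>vec_lists l k. card (carrier_vec n - span (set cs)))"
    by (simp add: card_SigmaI finite_vec_lists finite_carrier_vec)
  then have "real (card (Sigma (vec_lists l k) (\<lambda>cs. carrier_vec n - span (set cs)))) =
      (\<Sum>cs\<in>vec_lists l k. real (card (carrier_vec n - span (set cs))))"
    by simp
  also have "\<dots> = (\<Sum>cs\<in>vec_lists l k. real CARD('a) ^ n - real CARD('a) ^ k)"
  proof (rule sum.cong[OF HOL.refl])
    fix cs assume cs: "cs \<in> vec_lists l k"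
    have "card (span (set cs)) = CARD('a) ^ k"
      using cs by (auto simp: vec_lists_def card_span)
    \<comment> \<open>This makes the subtraction of cardinalities exact, so that it carries over to
      the reals.\<close>
    moreover have "card (span (set cs)) \<le> card (carrier_vec n :: 'a vec set)"
      by (rule card_mono[OF finite_carrier_vec sub[OF cs]])
    ultimately show "real (card (carrier_vec n - span (set cs))) = real CARD('a) ^ n - real CARD('a) ^ k"
      using card_Diff_subset[OF finite_subset[OF sub[OF cs] finite_carrier_vec] sub[OF cs]]
      by (simp add: card_carrier_vec of_nat_diff)
  qed
  finally show ?thesis by simp
qed

text \<open>The tail has dimension \<open>k\<close> if the head lies in its span and
  \<open>k - 1\<close> otherwise. The guard \<open>0 < k\<close> is there because
  \<open>k - 1\<close> is again 0 for \<open>k = 0\<close>.\<close>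

lemma vec_lists_Suc_conv:
  "vec_lists (Suc l) k = (\<lambda>(cs, c). c # cs) ` (Sigma (vec_lists l k) (\<lambda>cs. span (set cs)) \<union>
    {(cs, c). cs \<in> vec_lists l (k - 1) \<and> 0 < k \<and> c \<in> carrier_vec n - span (set cs)})"
  (is "_ = _ ` ?R")
proof -
  have sub: "span (set cs) \<subseteq> carrier_vec n" if "set cs \<subseteq> carrier_vec n" for cs
    using that span_is_subset2[of "set cs"] by auto
  have iff: "c # cs \<in> vec_lists (Suc l) k \<longleftrightarrow> (cs, c) \<in> ?R" for c cs
  proof (cases "set cs \<subseteq> carrier_vec n \<and> c \<in> carrier_vec n")
    case True
    then show ?thesis
      by (auto simp: vec_lists_def span_dim_insert)
  next
    case False
    then show ?thesis
      using sub[of cs] by (auto simp: vec_lists_def)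
  qed
  show ?thesis
  proof (intro equalityI subsetI)
    fix ds assume ds: "ds \<in> vec_lists (Suc l) k"
    then obtain c cs where "ds = c # cs" by (cases ds) (auto simp: vec_lists_def)
    with ds iff show "ds \<in> (\<lambda>(cs, c). c # cs) ` ?R" by force
  next
    fix ds assume "ds \<in> (\<lambda>(cs, c). c # cs) ` ?R"
    then obtain cs c where "(cs, c) \<in> ?R" "ds = c # cs" by (metis (no_types, lifting) imageE case_prod_conv surj_pair)
    with iff show "ds \<in> vec_lists (Suc l) k" by blast
  qed
qed

lemma card_vec_lists_Suc:
  "real (card (vec_lists (Suc l) k)) =
    real (card (vec_lists l k)) * real CARD('a) ^ k +
    (if k = 0 then 0
     else real (card (vec_lists l (k - 1))) * (real CARD('a) ^ n - real CARD('a) ^ (k - 1)))"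
proof -
  let ?S = "Sigma (vec_lists l k) (\<lambda>cs. span (set cs))"
  let ?T = "{(cs, c). cs \<in> vec_lists l (k - 1) \<and> 0 < k \<and> c \<in> carrier_vec n - span (set cs)}"
  have T: "?T = (if k = 0 then {} else Sigma (vec_lists l (k - 1)) (\<lambda>cs. carrier_vec n - span (set cs)))"
    by auto
  have finT: "finite ?T"
    unfolding T by (simp add: finite_vec_lists finite_carrier_vec)
  have "?S \<subseteq> vec_lists l k \<times> carrier_vec n"
    using span_is_subset2 by (fastforce simp: vec_lists_def)
  then have finS: "finite ?S"
    by (rule finite_subset) (simp add: finite_vec_lists finite_carrier_vec)
  have "card (vec_lists (Suc l) k) = card (?S \<union> ?T)"
    unfolding vec_lists_Suc_conv by (rule card_image) (auto simp: inj_on_def)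
  also have "\<dots> = card ?S + card ?T"
    using finS finT by (rule card_Un_disjoint) auto
  finally show ?thesis
    unfolding T by (simp add: card_Sigma_span card_Sigma_Diff_span)
qed

lemma span_dim_empty: "span_dim {} = 0"
  using span_dim_maximal_lin_indpt[of "{}" "{}"] by (auto simp: maximal_def lin_dep_def)

text \<open>Since \<open>power_diff_prod\<close> gains the factor \<open>q ^ n - q ^ k\<close> from
  \<open>k\<close> to \<open>Suc k\<close>, taking the product out of the recurrence leaves the
  Pascal rule for the list length.\<close>

lemma card_vec_lists:
  "real (card (vec_lists l k)) =
    gaussian_coeff CARD('a) l k * power_diff_prod (real CARD('a)) (real CARD('a) ^ n) k"
proof -
  have q: "2 \<le> CARD('a)"
    by (rule card_UNIV_ge_2)
  show ?thesis
  proof (induction l arbitrary: k)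
    case 0
    have "vec_lists 0 k = (if k = 0 then {[]} else {})"
      by (auto simp: vec_lists_def span_dim_empty)
    then show ?case
      by (cases k) (simp_all add: gaussian_coeff_eq_0)
  next
    case (Suc l)
    show ?case
      by (cases k) (simp_all add: card_vec_lists_Suc Suc gaussian_coeff_Suc_Suc[OF q] algebra_simps)
  qed
qed

lemma card_rank_eq:
  "real (card {A \<in> carrier_mat n nc :: 'a mat set. rank A = k}) =
    gaussian_coeff CARD('a) nc k * power_diff_prod (real CARD('a)) (real CARD('a) ^ n) k"
proof -
  have "bij_betw cols {A \<in> carrier_mat n nc :: 'a mat set. rank A = k} (vec_lists nc k)"
  proof (rule bij_betwI[where g = "mat_of_cols n"])
    show "cols \<in> {A \<in> carrier_mat n nc. rank A = k} \<rightarrow> vec_lists nc k"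
    proof
      fix A :: "'a mat" assume A: "A \<in> {A \<in> carrier_mat n nc. rank A = k}"
      then show "cols A \<in> vec_lists nc k"
        using cols_dim[of A] carrier_matD(1)[of A n nc] by (auto simp: vec_lists_def rank_def span_dim_def)
    qed
    show "mat_of_cols n \<in> vec_lists nc k \<rightarrow> {A \<in> carrier_mat n nc. rank A = k}"
      by (auto simp: vec_lists_def rank_def span_dim_def)
  qed (auto simp: vec_lists_def)
  then show ?thesis
    using bij_betw_same_card card_vec_lists by metis
qed

end

section \<open>The probability of a free minor\<close>

theorem theorem1:
  fixes M :: "'e matroid" and m n q :: nat
  assumes "q = CARD('a::{field,finite})"
    and "free_matroid M"
    and "m \<ge> matroid_rank M" and "n \<ge> matroid_rank M"
  shows "measure_pmf.prob (uniform_mat m n :: 'a mat pmf)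
           {A. is_minor M (column_matroid A)} =
         1 / real q ^ (m * n) *
         (\<Sum>k = matroid_rank M..min m n. gaussian_coeff q (min m n) k *
            (\<Sum>i = 0..k. (-1) ^ (k - i) * gaussian_coeff q k i *
               real q ^ (max m n * i + ((k - i) choose 2))))"
proof -
  \<comment> \<open>The columns are vectors of length \<open>m\<close>, so the dimension called
    \<open>n\<close> in the locale is \<open>m\<close> here, and \<open>n\<close> is the number of
    columns.\<close>
  interpret finite_vec_space "TYPE('a)" m .
  let ?C = "carrier_mat m n :: 'a mat set"
  define r where "r = matroid_rank M"
  have q: "2 \<le> q"
    using card_UNIV_ge_2[where 'a = 'a] assms(1) by simp
  have minor: "is_minor M (column_matroid A) \<longleftrightarrow> r \<le> rank A" if A: "A \<in> ?C" for A
  proof -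
    have down: "cols_indpt A J" if "cols_indpt A I" "J \<subseteq> I" for I J
      using that A subset_li_is_li[of "col A ` I" "col A ` J"]
      by (auto simp: cols_indpt_def intro: inj_on_subset)
    have "is_minor M (column_matroid A) \<longleftrightarrow> (\<exists>I\<in>indeps (column_matroid A). card I = r)"
      unfolding r_def using assms(2)
      by (rule free_matroid_is_minor_iff) (auto simp: column_matroid_def intro: down)
    also have "\<dots> \<longleftrightarrow> r \<le> rank A"
      using ex_card_lin_indpt_cols_iff[OF A, of r] A by (auto simp: column_matroid_def)
    finally show ?thesis .
  qed
  have card_C: "card ?C = q ^ (m * n)"
    using card_carrier_mat[of n] assms(1) by simp
  have "{A \<in> ?C. r \<le> rank A} = (\<Union>k\<in>{r..n}. {A \<in> ?C. rank A = k})"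
    using rank_le_nc by auto
  then have "card {A \<in> ?C. r \<le> rank A} = (\<Sum>k=r..n. card {A \<in> ?C. rank A = k})"
    using finite_carrier_mat[of m n] by (simp, intro card_UN_disjoint) auto
  then have "real (card {A \<in> ?C. r \<le> rank A}) =
      (\<Sum>k=r..n. gaussian_coeff q n k * power_diff_prod q (real q ^ m) k)"
    by (simp add: card_rank_eq assms(1))
  \<comment> \<open>The terms dropped have \<open>m < k\<close>, and the factor of index
    \<open>m\<close> in their product is 0.\<close>
  also have "\<dots> = (\<Sum>k=r..min m n. gaussian_coeff q n k * power_diff_prod q (real q ^ m) k)"
  proof (intro sum.mono_neutral_right ballI)
    fix k assume k: "k \<in> {r..n} - {r..min m n}"
    then have "power_diff_prod q (real q ^ m) k = 0"
      unfolding power_diff_prod_def by (intro prod_zero) (auto intro!: bexI[of _ m])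
    then show "gaussian_coeff q n k * power_diff_prod q (real q ^ m) k = 0" by simp
  qed auto
  \<comment> \<open>For \<open>m \<le> n\<close> this is the symmetry of the rank count; otherwise
    the terms already have this form.\<close>
  also have "\<dots> = (\<Sum>k=r..min m n. gaussian_coeff q (min m n) k * power_diff_prod q (real q ^ max m n) k)"
    using gaussian_coeff_mult_power_diff_prod_swap[OF q, of n _ m]
    by (intro sum.cong HOL.refl) (auto simp: min_def max_def)
  \<comment> \<open>The \<open>q\<close>-binomial theorem at \<open>x = q ^ max m n\<close>, with
    the two powers of \<open>q\<close> merged.\<close>
  also have "\<dots> = (\<Sum>k=r..min m n. gaussian_coeff q (min m n) k *
      (\<Sum>i=0..k. (-1) ^ (k - i) * gaussian_coeff q k i * real q ^ (max m n * i + ((k - i) choose 2))))"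
    by (simp add: q_binomial_theorem[OF q] power_add power_mult atMost_atLeast0 mult.assoc)
  finally have card_eq: "real (card {A \<in> ?C. r \<le> rank A}) = \<dots>" .
  have "measure_pmf.prob (uniform_mat m n :: 'a mat pmf) {A. is_minor M (column_matroid A)} =
      card (?C \<inter> {A. is_minor M (column_matroid A)}) / card ?C"
    unfolding uniform_mat_def
    by (rule measure_pmf_of_set[OF carrier_mat_nonempty finite_carrier_mat])
  also have "?C \<inter> {A. is_minor M (column_matroid A)} = {A \<in> ?C. r \<le> rank A}"
    using minor by auto
  finally show ?thesis
    unfolding card_eq card_C unfolding r_def by simp
qed

end
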